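(* Let $B:\mathbb{R}^n\times\mathbb{R}^n\to\mathbb{R}^n$ be a skew symmetric ($\mathbb{R}$-)bilinear operation on $\mathbb{R}^n$, and let $\mathcal{F}_B=\{(\mathrm{ad}_B(v),v) : v\in\mathbb{R}^n\}\subset\mathcal{E}_n=\mathfrak{gl}(n,\mathbb{R})\times\mathbb{R}^n$ be the graph of its adjoint operator. Then $B$ satisfies the Jacobi identity if and only if $\mathcal{F}_B$ is closed under the bracket operation $[\![\cdot,\cdot]\!]$ on $\mathcal{E}_n$ given by $$[\![(A_1,v_1),(A_2,v_2)]\!]=\left([A_1,A_2],\tfrac12(A_1v_2-A_2v_1)\right).$$ When this condition is satisfied, the restriction to $\mathcal{F}_B$ of the natural projection $\mathcal{E}_n\to\mathbb{R}^n$, $(A,v)\mapsto v$, is an isomorphism between the restriction to $\mathcal{F}_B$ of the bracket $[\![\cdot,\cdot]\!]$ and the operation $B$; that is, it is a linear isomorphism $\mathcal{F}_B\to\mathbb{R}^n$ which carries the restricted bracket to $B$.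
   Context: $\mathfrak{gl}(n,\mathbb{R})$ is the space of real $n\times n$ matrices (linear endomorphisms of $\mathbb{R}^n$), with commutator $[A_1,A_2]=A_1A_2-A_2A_1$. The space $\mathcal{E}_n=\mathfrak{gl}(n,\mathbb{R})\times\mathbb{R}^n$ is a real vector space with elements written $(A,v)$, and the bracket $[\![\cdot,\cdot]\!]$ on it is the antisymmetric bilinear operation given in the claim (it does not satisfy the Jacobi identity in general). For a bilinear operation $B$ on $\mathbb{R}^n$, the adjoint operator $\mathrm{ad}_B:\mathbb{R}^n\to\mathfrak{gl}(n,\mathbb{R})$ is defined by $\mathrm{ad}_B(v)(w)=B(v,w)$. A skew symmetric bilinear $B$ satisfies the Jacobi identity if $B(B(u,v),w)+B(B(v,w),u)+B(B(w,u),v)=0$ for all $u,v,w\in\mathbb{R}^n$. A subspace of $\mathcal{E}_n$ is closed under the bracket if the bracket of any two of its elements lies in it. *)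

theory Defs
  imports "HOL-Analysis.Analysis"
begin

type_synonym 'n gl = "real ^ 'n ^ 'n"

type_synonym 'n gl_space = "'n gl \<times> (real ^ 'n)"

definition commutator :: "'n::finite gl \<Rightarrow> 'n gl \<Rightarrow> 'n gl"
  where "commutator A1 A2 = A1 ** A2 - A2 ** A1"

definition gl_bracket :: "'n::finite gl_space \<Rightarrow> 'n gl_space \<Rightarrow> 'n gl_space"
  where "gl_bracket = (\<lambda>(A1, v1) (A2, v2).
    (commutator A1 A2, (1 / 2) *\<^sub>R (A1 *v v2 - A2 *v v1)))"

definition skew_symmetric :: "('a::real_vector \<Rightarrow> 'a \<Rightarrow> 'a) \<Rightarrow> bool"
  where "skew_symmetric B \<longleftrightarrow> (\<forall>u v. B u v = - B v u)"

definition jacobi_identity :: "('a::real_vector \<Rightarrow> 'a \<Rightarrow> 'a) \<Rightarrow> bool"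
  where "jacobi_identity B \<longleftrightarrow>
    (\<forall>u v w. B (B u v) w + B (B v w) u + B (B w u) v = 0)"

text \<open>The endomorphism \<open>w \<mapsto> B(v, w)\<close>, as a matrix in the standard basis; this is
  meaningful when \<open>B\<close> is linear in its second argument.\<close>
definition ad :: "(real ^ 'n \<Rightarrow> real ^ 'n \<Rightarrow> real ^ 'n) \<Rightarrow> real ^ 'n \<Rightarrow> 'n::finite gl"
  where "ad B v = matrix (\<lambda>w. B v w)"

definition ad_graph :: "(real ^ 'n \<Rightarrow> real ^ 'n \<Rightarrow> real ^ 'n) \<Rightarrow> 'n::finite gl_space set"
  where "ad_graph B = {(ad B v, v) | v. True}"

definition closed_under :: "('a \<Rightarrow> 'a \<Rightarrow> 'a) \<Rightarrow> 'a set \<Rightarrow> bool"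
  where "closed_under br S \<longleftrightarrow> (\<forall>x\<in>S. \<forall>y\<in>S. br x y \<in> S)"

definition linear_iso_on ::
    "'a::real_vector set \<Rightarrow> 'b::real_vector set \<Rightarrow> ('a \<Rightarrow> 'b) \<Rightarrow> bool"
  where "linear_iso_on S T f \<longleftrightarrow>
    subspace S \<and> subspace T \<and>
    (\<forall>x\<in>S. \<forall>y\<in>S. f (x + y) = f x + f y) \<and>
    (\<forall>c. \<forall>x\<in>S. f (c *\<^sub>R x) = c *\<^sub>R f x) \<and>
    bij_betw f S T"

text \<open>Closedness of \<open>S\<close> and \<open>T\<close> is part of the notion: otherwise the brackets do not
  restrict to operations on them.\<close>
definition bracket_iso_on ::
    "'a::real_vector set \<Rightarrow> ('a \<Rightarrow> 'a \<Rightarrow> 'a) \<Rightarrow>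
     'b::real_vector set \<Rightarrow> ('b \<Rightarrow> 'b \<Rightarrow> 'b) \<Rightarrow> ('a \<Rightarrow> 'b) \<Rightarrow> bool"
  where "bracket_iso_on S br T br' f \<longleftrightarrow>
    closed_under br S \<and> closed_under br' T \<and> linear_iso_on S T f \<and>
    (\<forall>x\<in>S. \<forall>y\<in>S. f (br x y) = br' (f x) (f y))"

end

theory Submission imports Defs begin

text \<open>
  A pair \<open>(A, v)\<close> lies in the graph exactly when \<open>A = ad B v\<close>. On two graph elements over
  \<open>u\<close> and \<open>v\<close>, skew symmetry merges the two halves \<open>B u v / 2\<close> and \<open>- B v u / 2\<close> of the second
  component, so the bracket is \<open>([ad u, ad v], B u v)\<close>. Hence the bracket always projects to \<open>B\<close>,
  and it stays in the graph if and only if \<open>[ad u, ad v] = ad (B u v)\<close>. Evaluated on a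
  vector \<open>w\<close>, this last equation is the Leibniz form
  \<open>B u (B v w) - B v (B u w) = B (B u v) w\<close> of the Jacobi identity. The projection of
  a graph to its domain is bijective, and it is linear because \<open>ad B\<close> is linear.
\<close>

lemma ad_mult_vec:
  assumes "bilinear B"
  shows "ad B v *v w = B v w"
  using assms by (simp add: ad_def bilinear_def matrix_works)

lemma linear_ad:
  assumes "bilinear B"
  shows "linear (ad B)"
proof (rule linearI)
  show "ad B (u + v) = ad B u + ad B v" for u v
    by (simp add: matrix_eq matrix_vector_mult_add_rdistrib ad_mult_vec[OF assms]
        bilinear_ladd[OF assms])
  show "ad B (c *\<^sub>R v) = c *\<^sub>R ad B v" for c v
    by (simp add: matrix_eq scaleR_matrix_vector_assoc[symmetric] ad_mult_vec[OF assms]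
        bilinear_lmul[OF assms])
qed

lemma gl_bracket_ad:
  assumes "bilinear B" "skew_symmetric B"
  shows "gl_bracket (ad B u, u) (ad B v, v) = (commutator (ad B u) (ad B v), B u v)"
proof -
  have "B u v - B v u = 2 *\<^sub>R B u v"
    using assms(2)[unfolded skew_symmetric_def, rule_format, of v u]
    by (simp add: scaleR_2)
  then show ?thesis
    by (simp add: gl_bracket_def ad_mult_vec[OF assms(1)])
qed

lemma commutator_ad_mult_vec:
  assumes "bilinear B"
  shows "commutator (ad B u) (ad B v) *v w = B u (B v w) - B v (B u w)"
  by (simp add: commutator_def matrix_vector_mult_diff_rdistrib ad_mult_vec[OF assms]
      matrix_vector_mul_assoc[symmetric])

text \<open>Moving the inner bracket to the second argument in two of the three cyclic terms costs
  a sign each by skew symmetry, and one further sign turns \<open>B w u\<close> into \<open>B u w\<close>; the cyclic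
  sum thus becomes the statement that \<open>ad B\<close> respects brackets.\<close>
lemma jacobi_identity_iff_commutator_ad:
  assumes "bilinear B" "skew_symmetric B"
  shows "jacobi_identity B \<longleftrightarrow> (\<forall>u v. commutator (ad B u) (ad B v) = ad B (B u v))"
proof -
  have skew: "B x y = - B y x" for x y
    using assms(2) unfolding skew_symmetric_def by blast
  have cyclic_sum: "B (B u v) w + B (B v w) u + B (B w u) v
      = - (B u (B v w) - B v (B u w) - B (B u v) w)" for u v w
  proof -
    have "B (B v w) u = - B u (B v w)"
      by (rule skew)
    moreover have "B (B w u) v = B v (B u w)"
      using skew[of "B w u" v] skew[of w u] by (simp add: bilinear_rneg[OF assms(1)])
    ultimately show ?thesis by simp
  qed
  have "jacobi_identity B \<longleftrightarrow>
      (\<forall>u v w. B u (B v w) - B v (B u w) = B (B u v) w)"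
    by (simp only: jacobi_identity_def cyclic_sum neg_equal_0_iff_equal right_minus_eq)
  then show ?thesis
    by (simp add: matrix_eq commutator_ad_mult_vec[OF assms(1)] ad_mult_vec[OF assms(1)])
qed

lemma closed_under_ad_graph_iff:
  assumes "bilinear B" "skew_symmetric B"
  shows "closed_under gl_bracket (ad_graph B) \<longleftrightarrow>
    (\<forall>u v. commutator (ad B u) (ad B v) = ad B (B u v))"
  by (auto simp: closed_under_def ad_graph_def gl_bracket_ad[OF assms])

lemma linear_iso_on_ad_graph_snd:
  assumes "bilinear B"
  shows "linear_iso_on (ad_graph B) UNIV snd"
proof -
  have graph: "ad_graph B = range (\<lambda>v. (ad B v, v))"
    by (auto simp: ad_graph_def)
  have "linear (\<lambda>v. (ad B v, v))"
    using linear_ad[OF assms] by (simp add: linear_iff)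
  then have "subspace (ad_graph B)"
    unfolding graph by (intro linear_subspace_image subspace_UNIV)
  moreover have "bij_betw snd (ad_graph B) UNIV"
    by (auto simp: graph bij_betw_def inj_on_def image_image)
  ultimately show ?thesis
    by (simp add: linear_iso_on_def)
qed

theorem proposition1p1:
  fixes B :: "real ^ 'n \<Rightarrow> real ^ 'n \<Rightarrow> real ^ 'n::finite"
  assumes "bilinear B" and "skew_symmetric B"
  shows "(jacobi_identity B \<longleftrightarrow> closed_under gl_bracket (ad_graph B)) \<and>
    (jacobi_identity B \<longrightarrow> bracket_iso_on (ad_graph B) gl_bracket UNIV B snd)"
proof -
  have closed_iff: "jacobi_identity B \<longleftrightarrow> closed_under gl_bracket (ad_graph B)"
    by (simp add: jacobi_identity_iff_commutator_ad[OF assms] closed_under_ad_graph_iff[OF assms])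
  have "\<forall>x\<in>ad_graph B. \<forall>y\<in>ad_graph B. snd (gl_bracket x y) = B (snd x) (snd y)"
    by (auto simp: ad_graph_def gl_bracket_ad[OF assms])
  then have "bracket_iso_on (ad_graph B) gl_bracket UNIV B snd" if "jacobi_identity B"
    using that closed_iff linear_iso_on_ad_graph_snd[OF assms(1)]
    by (simp add: bracket_iso_on_def closed_under_def)
  with closed_iff show ?thesis by blast
qed

end
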